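(* Let $U$ be a nonempty set, $\varphi$ an MSO formula, $x$ a first-order variable and $X$ a monadic second-order variable that does not occur free in $\varphi$. Then $$\models^{d'}\ \exists X.\,\forall x.\,(X(x)\leftrightarrow\varphi).$$
   Context: **Syntax.** Relation symbols $R=\mathbb N$, first-order variables $V=\mathbb N$ and second-order (monadic) variables $V_2=\mathbb N$ (the two kinds of variables form separate namespaces). MSO formulas: $\varphi,\psi ::= r(x,y)\mid X(x)\mid\neg\varphi\mid\varphi\wedge\psi\mid\exists x.\varphi\mid\exists X.\varphi$ with $r\in R$, $x,y\in V$, $X\in V_2$ (no equality). The connectives $\vee,\supset,\leftrightarrow$ and the universals $\forall x.\varphi:=\neg\exists x.\neg\varphi$, $\forall X.\varphi:=\neg\exists X.\neg\varphi$ are the usual abbreviations. **Semantics.** $U$ is a fixed nonempty set (the type of individuals). An interpretation $I$ over $U$ assigns to each $r\in R$ a binary relation $I(r)\subseteq U\times U$. Given $I$, $D\subseteq U$, $E\subseteq\mathcal P(U)$, $g:V\to U$, $G:V_2\to\mathcal P(U)$, truth $\langle I,D,E\rangle,g,G\models^d\varphi$ is defined recursively: $r(x,y)$ holds iff $(g(x),g(y))\in I(r)$; $X(x)$ holds iff $g(x)\in G(X)$; $\neg,\wedge$ are classical; $\exists x.\varphi$ holds iff $\langle I,D,E\rangle,g[x\leftarrow d],G\models^d\varphi$ for some $d\in D$; $\exists X.\varphi$ holds iff $\langle I,D,E\rangle,g,G\langle X\leftarrow S\rangle\models^d\varphi$ for some $S\in E$. Here $g[x\leftarrow d]$ and $G\langle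 X\leftarrow S\rangle$ are the usual updates. **Standard validity.** $\models^{d'}\varphi$ means: for all $I$, $g:V\to U$, $G:V_2\to\mathcal P(U)$, $\langle I,U,\mathcal P(U)\rangle,g,G\models^d\varphi$. *)

theory Defs
  imports Main
begin

type_synonym rel_sym = nat
type_synonym fo_var = nat
type_synonym so_var = nat

datatype mso =
    Rel rel_sym fo_var fo_var
  | Mem so_var fo_var  (* Mem X x is the atom X(x) *)
  | Neg mso
  | Conj mso mso
  | ExFO fo_var mso
  | ExSO so_var mso

abbreviation Disj :: "mso \<Rightarrow> mso \<Rightarrow> mso" where
  "Disj \<phi> \<psi> \<equiv> Neg (Conj (Neg \<phi>) (Neg \<psi>))"

abbreviation Impl :: "mso \<Rightarrow> mso \<Rightarrow> mso" where
  "Impl \<phi> \<psi> \<equiv> Disj (Neg \<phi>) \<psi>"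

abbreviation Equi :: "mso \<Rightarrow> mso \<Rightarrow> mso" where
  "Equi \<phi> \<psi> \<equiv> Conj (Impl \<phi> \<psi>) (Impl \<psi> \<phi>)"

abbreviation AllFO :: "fo_var \<Rightarrow> mso \<Rightarrow> mso" where
  "AllFO x \<phi> \<equiv> Neg (ExFO x (Neg \<phi>))"

abbreviation AllSO :: "so_var \<Rightarrow> mso \<Rightarrow> mso" where
  "AllSO X \<phi> \<equiv> Neg (ExSO X (Neg \<phi>))"

primrec free_so :: "mso \<Rightarrow> so_var set" where
  "free_so (Rel r x y) = {}"
| "free_so (Mem X x) = {X}"
| "free_so (Neg \<phi>) = free_so \<phi>"
| "free_so (Conj \<phi> \<psi>) = free_so \<phi> \<union> free_so \<psi>"
| "free_so (ExFO x \<phi>) = free_so \<phi>"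
| "free_so (ExSO X \<phi>) = free_so \<phi> - {X}"

primrec truth ::
  "(rel_sym \<Rightarrow> ('u \<times> 'u) set) \<Rightarrow> 'u set \<Rightarrow> 'u set set \<Rightarrow>
   (fo_var \<Rightarrow> 'u) \<Rightarrow> (so_var \<Rightarrow> 'u set) \<Rightarrow> mso \<Rightarrow> bool" where
  "truth I D E g G (Rel r x y) \<longleftrightarrow> (g x, g y) \<in> I r"
| "truth I D E g G (Mem X x) \<longleftrightarrow> g x \<in> G X"
| "truth I D E g G (Neg \<phi>) \<longleftrightarrow> \<not> truth I D E g G \<phi>"
| "truth I D E g G (Conj \<phi> \<psi>) \<longleftrightarrow> truth I D E g G \<phi> \<and> truth I D E g G \<psi>"
| "truth I D E g G (ExFO x \<phi>) \<longleftrightarrow> (\<exists>d\<in>D. truth I D E (g(x := d)) G \<phi>)"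
| "truth I D E g G (ExSO X \<phi>) \<longleftrightarrow> (\<exists>S\<in>E. truth I D E g (G(X := S)) \<phi>)"

(* The set U of individuals is an explicit carrier inside the type 'u, so
   interpretations and assignments are restricted to those over U. *)
definition std_valid :: "'u set \<Rightarrow> mso \<Rightarrow> bool" where
  "std_valid U \<phi> \<longleftrightarrow>
     (\<forall>I g G. (\<forall>r. I r \<subseteq> U \<times> U) \<longrightarrow> (\<forall>x. g x \<in> U) \<longrightarrow> (\<forall>X. G X \<subseteq> U) \<longrightarrow>
        truth I U (Pow U) g G \<phi>)"

end

theory Submission
  imports Defs
begin

text \<open>Comprehension holds because the second-order quantifier ranges over all subsets of U, so
  the set that \<phi> defines is itself available as a witness. The one danger is circularity:
  giving X this value could change the meaning of \<phi>. \<open>truth_cong_free_so\<close> excludes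
  that, since truth depends on a second-order assignment only through the free variables.\<close>

lemma truth_cong_free_so:
  assumes "\<And>Y. Y \<in> free_so \<phi> \<Longrightarrow> G Y = H Y"
  shows "truth I D E g G \<phi> \<longleftrightarrow> truth I D E g H \<phi>"
  using assms
proof (induction \<phi> arbitrary: g G H)
  case (Conj \<phi> \<psi>)
  have "truth I D E g G \<phi> \<longleftrightarrow> truth I D E g H \<phi>"
    by (rule Conj.IH) (simp add: Conj.prems)
  moreover have "truth I D E g G \<psi> \<longleftrightarrow> truth I D E g H \<psi>"
    by (rule Conj.IH) (simp add: Conj.prems)
  ultimately show ?case by simp
next
  case (Neg \<phi>)
  have "truth I D E g G \<phi> \<longleftrightarrow> truth I D E g H \<phi>"
    by (rule Neg.IH) (simp add: Neg.prems)
  then show ?case by simp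
next
  case (ExFO x \<phi>)
  have "truth I D E (g(x := d)) G \<phi> \<longleftrightarrow> truth I D E (g(x := d)) H \<phi>" for d
    by (rule ExFO.IH) (simp add: ExFO.prems)
  then show ?case by simp
next
  case (ExSO X \<phi>)
  \<comment> \<open>The premise covers only \<open>free_so \<phi> - {X}\<close>; at X itself both
    updated assignments take the value S.\<close>
  have "truth I D E g (G(X := S)) \<phi> \<longleftrightarrow> truth I D E g (H(X := S)) \<phi>" for S
    by (rule ExSO.IH) (simp add: ExSO.prems)
  then show ?case by simp
qed simp_all

theorem mainTheorem7:
  fixes U :: "'u set" and \<phi> :: mso and x :: fo_var and X :: so_var
  assumes "U \<noteq> {}"
    and "X \<notin> free_so \<phi>"
  shows "std_valid U (ExSO X (AllFO x (Equi (Mem X x) \<phi>)))"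
  unfolding std_valid_def
proof (intro allI impI)
  fix I g and G :: "so_var \<Rightarrow> 'u set"
  \<comment> \<open>The extension of \<phi> in x, read under the original G, so that S is not
    defined in terms of itself.\<close>
  define S where "S = {d \<in> U. truth I U (Pow U) (g(x := d)) G \<phi>}"
  \<comment> \<open>The two assignments can differ only at X, which is not free in \<phi>; so S is
    still the extension of \<phi> once X denotes S.\<close>
  have "truth I U (Pow U) (g(x := d)) (G(X := S)) \<phi> \<longleftrightarrow> truth I U (Pow U) (g(x := d)) G \<phi>" for d
    by (rule truth_cong_free_so) (use assms(2) in auto)
  then have "truth I U (Pow U) g (G(X := S)) (AllFO x (Equi (Mem X x) \<phi>))"
    by (simp add: S_def)
  moreover have "S \<in> Pow U"
    by (auto simp: S_def)
  ultimately show "truth I U (Pow U) g G (ExSO X (AllFO x (Equi (Mem X x) \<phi>)))"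
    unfolding truth.simps(6) by blast
qed

end
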